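(* Let $N>2$ and let $g=(g_{i,j})_{i,j=0}^{N-1}\in SL_N(L^\infty(\mathbb{T}))$, with rows $\tilde g_i(z)=(g_{i,j}(z))_{j=0}^{N-1}\in\mathbb{C}^N$. For a.e. $z\in\mathbb{T}$ let $P(z)$ be the orthogonal projection of $\mathbb{C}^N$ onto the one-dimensional subspace spanned by $\tilde g_0(z)$. Consider all factorizations $$g(z)=\begin{pmatrix}1&0&0&\cdots&0\\ L_1(z)&1&0&\cdots&0\\ L_2(z)&0&1&\ddots&0\\ \vdots&\vdots&\ddots&\ddots&\vdots\\ L_{N-1}(z)&0&\cdots&0&1\end{pmatrix}g^{(new)}(z),\qquad L_i\in L^\infty(\mathbb{T}),\ g^{(new)}\in SL_N(L^\infty(\mathbb{T})),$$ and for each of them let $f_1,\dots,f_{N-1}\in L^\infty(\mathbb{T})$ be the functions determined by $g^{(new)}_{i,j}=S_j^*f_i$ for $1\le i\le N-1$, $0\le j\le N-1$. Then: (i) the optimal choice of factorization is the one for which the matrix factor $g^{(new)}$ has as its rows of index $i=1,\dots,N-1$ the vector fields $$\tilde g_i^{(new)}(z)=\tilde g_i(z)-P(z)\tilde g_i(z)$$ (the row of index $0$ being $\tilde g_0$); (ii) writing $\tilde g_i^{(new)}=(S_0^*f_i,S_1^*f_i,\dots,S_{N-1}^*f_i)$, the optimal solution in (i) is attained and is the unique minimizer of the system of optimization problems $$\min\ \|f_i\|_{L^2(\mathbb{T})}^2,\qquad 1\le i<N,$$ the minimum being over all $(f_i)_{i=1}^{N-1}$ arising, via $g^{(new)}_{i,j}=S_j^*f_i$,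 from factorizations $g=\Lambda\, g^{(new)}$ in which $g^{(new)}\in SL_N(L^\infty(\mathbb{T}))$ and $\Lambda$ is the lower triangular $N\times N$ matrix function with $1$'s on the diagonal, first column $(1,L_1,\dots,L_{N-1})^T$ with $L_1,\dots,L_{N-1}\in L^\infty(\mathbb{T})$, and all other entries $0$.
   Context: $\mathbb{T}$ is the unit circle with normalized Haar measure. $SL_N(L^\infty(\mathbb{T}))$ is the group of $N\times N$ matrices over $L^\infty(\mathbb{T})$ with determinant $1$ a.e. The inner product on $\mathbb{C}^N$ is $\langle z,w\rangle=\sum_{j=0}^{N-1}\overline{z_j}w_j$, so that $P(z)\xi=\frac{\langle \tilde g_0(z),\xi\rangle}{\|\tilde g_0(z)\|_2^2}\,\tilde g_0(z)$ for $\xi\in\mathbb{C}^N$. The operators $S_j$, $j=0,\dots,N-1$, are the isometries on $L^2(\mathbb{T})$ given by $(S_j\psi)(z)=z^j\psi(z^N)$, with adjoints $(S_j^*\psi)(z)=\frac1N\sum_{w^N=z}\overline{w}^{\,j}\psi(w)$; they satisfy $S_i^*S_j=\delta_{i,j}I$ and $\sum_iS_iS_i^*=I$. In any factorization of $g$ as a lower triangular factor times $g^{(new)}\in SL_N(L^\infty(\mathbb{T}))$, where the lower triangular factor has $1$'s on the diagonal, first column $(1,L_1,\dots,L_{N-1})^T$ with $L_i\in L^\infty(\mathbb{T})$, and all other entries $0$, the functions $f_i$ exist and are unique, $f_i=\sum_jS_jg^{(new)}_{i,j}$. "Optimal" means that $\|f_i\|_{L^2(\mathbb{T})}^2$ is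 minimal for every $i=1,\dots,N-1$. *)

theory Defs
  imports "HOL-Analysis.Analysis" "Jordan_Normal_Form.Determinant"
begin

text \<open>The unit circle with normalized Haar measure, as the image of Lebesgue measure on
  \<open>[0, 1)\<close> under \<open>t \<mapsto> exp (2 \<pi> i t)\<close>. Its underlying space is the circle itself, so values of
  functions off the circle play no role.\<close>

definition circle_haar :: "complex measure" where
  "circle_haar = distr (restrict_space lborel {0..<1::real})
     (restrict_space borel (sphere 0 1)) (\<lambda>t. cis (2 * pi * t))"

lemma space_circle_haar [simp]: "space circle_haar = sphere 0 1"
  by (simp add: circle_haar_def space_restrict_space)

lemma sets_circle_haar [measurable_cong, simp]:
  "sets circle_haar = sets (restrict_space borel (sphere 0 1))"
  by (simp add: circle_haar_def)

lemma circle_param_measurable: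
  "(\<lambda>t. cis (2 * pi * t)) \<in> restrict_space lborel {0..<1::real} \<rightarrow>\<^sub>M restrict_space borel (sphere 0 1)"
proof (rule measurable_restrict_space2)
  show "(\<lambda>t. cis (2 * pi * t)) \<in> restrict_space lborel {0..<1::real} \<rightarrow>\<^sub>M borel"
    by (intro measurable_restrict_space1) (simp add: cis_conv_exp borel_measurable_continuous_onI
          continuous_intros)
qed auto

lemma emeasure_circle_haar:
  assumes "A \<in> sets (restrict_space borel (sphere 0 1))"
  shows "emeasure circle_haar A = emeasure lborel {t. 0 \<le> t \<and> t < 1 \<and> cis (2 * pi * t) \<in> A}"
proof -
  have "emeasure circle_haar A = emeasure (restrict_space lborel {0..<1::real})
      ((\<lambda>t. cis (2 * pi * t)) -` A \<inter> space (restrict_space lborel {0..<1::real}))"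
    unfolding circle_haar_def by (rule emeasure_distr[OF circle_param_measurable assms])
  also have "(\<lambda>t. cis (2 * pi * t)) -` A \<inter> space (restrict_space lborel {0..<1::real})
      = {t. 0 \<le> t \<and> t < 1 \<and> cis (2 * pi * t) \<in> A}"
    by (auto simp: space_restrict_space)
  also have "emeasure (restrict_space lborel {0..<1::real}) \<dots> = emeasure lborel \<dots>"
    by (rule emeasure_restrict_space) auto
  finally show ?thesis .
qed

lemma prob_circle_haar: "emeasure circle_haar (space circle_haar) = 1"
proof -
  have "emeasure circle_haar (sphere 0 1) = emeasure lborel {0..<1::real}"
    by (subst emeasure_circle_haar)
       (auto simp: sets_restrict_space atLeastLessThan_def atLeast_def lessThan_def Collect_conj_eq
         intro!: arg_cong[where f="emeasure lborel"])
  then show ?thesis by simp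
qed

lemma rotation_invariant_circle_haar:
  assumes c: "norm c = 1"
  shows "distr circle_haar circle_haar (\<lambda>z. c * z) = circle_haar"
proof (rule measure_eqI)
  have m: "(\<lambda>z. c * z) \<in> circle_haar \<rightarrow>\<^sub>M circle_haar"
    unfolding measurable_cong_sets[OF sets_circle_haar sets_circle_haar]
    by (intro measurable_restrict_space2 measurable_restrict_space1)
       (auto simp: space_restrict_space norm_mult c borel_measurable_continuous_onI continuous_intros)
  fix A assume "A \<in> sets (distr circle_haar circle_haar (\<lambda>z. c * z))"
  then have A: "A \<in> sets (restrict_space borel (sphere 0 1))" by simp
  then have Ab: "A \<in> sets borel" and As: "A \<subseteq> sphere 0 1"
    by (auto simp: sets_restrict_space)
  obtain s0 where s0: "c = cis (2 * pi * s0)"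
  proof -
    have "c = cis (2 * pi * (Arg c / (2 * pi)))" using c rcis_cmod_Arg[of c] by (simp add: rcis_def)
    then show ?thesis by (rule that)
  qed
  define s where "s = frac s0"
  have per: "cis (2 * pi * (t + of_int k)) = cis (2 * pi * t)" for t and k :: int
    by (simp add: distrib_left flip: cis_mult)
  have "cis (2 * pi * s) = cis (2 * pi * (s + of_int \<lfloor>s0\<rfloor>))" by (rule per[symmetric])
  also have "s + of_int \<lfloor>s0\<rfloor> = s0" by (simp add: s_def frac_def)
  finally have sc: "cis (2 * pi * s) = c" by (simp add: s0)
  have s: "0 \<le> s" "s < 1" by (auto simp: s_def frac_lt_1)
  define E where "E = {t::real. cis (2 * pi * t) \<in> A}"
  have Eb [measurable]: "E \<in> sets borel"
  proof -
    have "(\<lambda>t. cis (2 * pi * t)) \<in> borel_measurable borel"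
      by (simp add: cis_conv_exp borel_measurable_continuous_onI continuous_intros)
    from measurable_sets[OF this Ab] show ?thesis by (simp add: E_def vimage_def)
  qed
  have Eper: "t + 1 \<in> E \<longleftrightarrow> t \<in> E" for t using per[of t 1] by (simp add: E_def)
  have shift: "emeasure lborel {t. t + a \<in> B} = emeasure lborel B"
    if [measurable]: "B \<in> sets borel" for B and a :: real
  proof -
    have "emeasure lborel B = emeasure (distr lborel borel ((+) a)) B"
      by (simp add: lborel_distr_plus)
    also have "\<dots> = emeasure lborel {t. t + a \<in> B}"
      by (subst emeasure_distr) (auto simp: vimage_def add.commute)
    finally show ?thesis by simp
  qed
  have "emeasure (distr circle_haar circle_haar (\<lambda>z. c * z)) A
      = emeasure circle_haar ((\<lambda>z. c * z) -` A \<inter> space circle_haar)"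
    by (rule emeasure_distr[OF m]) (use A in simp)
  also have "\<dots> = emeasure lborel {t. 0 \<le> t \<and> t < 1 \<and> cis (2 * pi * t) \<in> (\<lambda>z. c * z) -` A \<inter> space circle_haar}"
    by (rule emeasure_circle_haar) (use measurable_sets[OF m, of A] A in simp)
  also have "{t. 0 \<le> t \<and> t < 1 \<and> cis (2 * pi * t) \<in> (\<lambda>z. c * z) -` A \<inter> space circle_haar}
      = {t. t + s \<in> E \<inter> {s..<s+1}}"
    by (auto simp: E_def cis_mult distrib_left add.commute simp flip: sc)
  also have "emeasure lborel \<dots> = emeasure lborel (E \<inter> {s..<s+1})"
    by (rule shift) measurable
  also have "E \<inter> {s..<s+1} = (E \<inter> {s..<1}) \<union> (E \<inter> {1..<s+1})" using s by auto
  also have "emeasure lborel \<dots> = emeasure lborel (E \<inter> {s..<1}) + emeasure lborel (E \<inter> {1..<s+1})"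
    by (rule plus_emeasure[symmetric]) auto
  also have "emeasure lborel (E \<inter> {1..<s+1}) = emeasure lborel {t. t + 1 \<in> E \<inter> {1..<s+1}}"
    by (rule shift[symmetric]) measurable
  also have "{t. t + 1 \<in> E \<inter> {1..<s+1}} = E \<inter> {0..<s}" using Eper by auto
  also have "emeasure lborel (E \<inter> {s..<1}) + emeasure lborel (E \<inter> {0..<s})
      = emeasure lborel ((E \<inter> {s..<1}) \<union> (E \<inter> {0..<s}))"
    by (rule plus_emeasure) auto
  also have "(E \<inter> {s..<1}) \<union> (E \<inter> {0..<s}) = {t. 0 \<le> t \<and> t < 1 \<and> cis (2 * pi * t) \<in> A}"
    using s by (auto simp: E_def)
  also have "emeasure lborel \<dots> = emeasure circle_haar A"
    by (rule emeasure_circle_haar[OF A, symmetric])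
  finally show "emeasure (distr circle_haar circle_haar (\<lambda>z. c * z)) A = emeasure circle_haar A" .
qed simp

definition Linf :: "(complex \<Rightarrow> complex) set" where
  "Linf = {f \<in> borel_measurable circle_haar. \<exists>C. AE z in circle_haar. norm (f z) \<le> C}"

definition L2_norm :: "(complex \<Rightarrow> complex) \<Rightarrow> real" where
  "L2_norm f = sqrt (\<integral>z. (norm (f z))\<^sup>2 \<partial>circle_haar)"

definition SL_Linf :: "nat \<Rightarrow> (complex \<Rightarrow> complex mat) set" where
  "SL_Linf N = {g. (\<forall>z\<in>sphere 0 1. g z \<in> carrier_mat N N) \<and>
     (\<forall>i<N. \<forall>j<N. (\<lambda>z. g z $$ (i, j)) \<in> Linf) \<and>
     (AE z in circle_haar. Determinant.det (g z) = 1)}"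

definition lower_factor :: "nat \<Rightarrow> (nat \<Rightarrow> complex \<Rightarrow> complex) \<Rightarrow> complex \<Rightarrow> complex mat" where
  "lower_factor N L z =
     mat N N (\<lambda>(i, j). if i = j then 1 else if j = 0 then L i z else 0)"

definition is_factorization ::
  "nat \<Rightarrow> (complex \<Rightarrow> complex mat) \<Rightarrow> (nat \<Rightarrow> complex \<Rightarrow> complex) \<Rightarrow> (complex \<Rightarrow> complex mat) \<Rightarrow> bool" where
  "is_factorization N g L h \<longleftrightarrow>
     (\<forall>i\<in>{1..<N}. L i \<in> Linf) \<and> h \<in> SL_Linf N \<and>
     (AE z in circle_haar. g z = lower_factor N L z * h z)"

text \<open>The operator \<open>S\<^sub>j\<^sup>*\<close>, where \<open>(S\<^sub>j \<psi>)(z) = z\<^sup>j \<psi>(z\<^sup>N)\<close>.\<close>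

definition S_adj :: "nat \<Rightarrow> nat \<Rightarrow> (complex \<Rightarrow> complex) \<Rightarrow> complex \<Rightarrow> complex" where
  "S_adj N j \<psi> z = (1 / of_nat N) * (\<Sum>w | w ^ N = z. cnj w ^ j * \<psi> w)"

text \<open>Only the components \<open>f i\<close> with \<open>1 \<le> i < N\<close> of the family \<open>f\<close> are meaningful.\<close>

definition represents :: "nat \<Rightarrow> (nat \<Rightarrow> complex \<Rightarrow> complex) \<Rightarrow> (complex \<Rightarrow> complex mat) \<Rightarrow> bool" where
  "represents N f h \<longleftrightarrow>
     (\<forall>i\<in>{1..<N}. f i \<in> Linf \<and>
        (\<forall>j<N. AE z in circle_haar. h z $$ (i, j) = S_adj N j (f i) z))"

definition admissible :: "nat \<Rightarrow> (complex \<Rightarrow> complex mat) \<Rightarrow> (nat \<Rightarrow> complex \<Rightarrow> complex) \<Rightarrow> bool" where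
  "admissible N g f \<longleftrightarrow> (\<exists>L h. is_factorization N g L h \<and> represents N f h)"

definition is_minimizer ::
  "nat \<Rightarrow> (complex \<Rightarrow> complex mat) \<Rightarrow> nat \<Rightarrow> (nat \<Rightarrow> complex \<Rightarrow> complex) \<Rightarrow> bool" where
  "is_minimizer N g i f \<longleftrightarrow> is_arg_min (\<lambda>f. (L2_norm (f i))\<^sup>2) (admissible N g) f"

definition is_optimal ::
  "nat \<Rightarrow> (complex \<Rightarrow> complex mat) \<Rightarrow> (nat \<Rightarrow> complex \<Rightarrow> complex) \<Rightarrow> (complex \<Rightarrow> complex mat) \<Rightarrow> bool" where
  "is_optimal N g L h \<longleftrightarrow> is_factorization N g L h \<and>
     (\<exists>f. represents N f h \<and> (\<forall>i\<in>{1..<N}. is_minimizer N g i f))"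

text \<open>Orthogonal projection of \<open>\<xi>\<close> onto the line spanned by \<open>v\<close>. Note that \<open>\<xi> \<bullet>c v\<close> is conjugate
  linear in its second argument \<open>v\<close>, so it is the inner product of \<open>v\<close> and \<open>\<xi>\<close> in the convention
  that conjugates the first argument.\<close>

definition line_proj :: "complex vec \<Rightarrow> complex vec \<Rightarrow> complex vec" where
  "line_proj v \<xi> = ((\<xi> \<bullet>c v) / (v \<bullet>c v)) \<cdot>\<^sub>v v"

lemma line_proj_orthogonal:
  assumes v: "v \<in> carrier_vec n" "v \<noteq> 0\<^sub>v n" and \<xi>: "\<xi> \<in> carrier_vec n"
  shows "(\<xi> - line_proj v \<xi>) \<bullet>c v = 0"
proof -
  have "v \<bullet>c v \<noteq> 0" using conjugate_square_eq_0_vec[OF v(1)] v(2) by simp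
  moreover have "(\<xi> - line_proj v \<xi>) \<bullet>c v = \<xi> \<bullet>c v - line_proj v \<xi> \<bullet>c v"
    using v \<xi> by (intro minus_scalar_prod_distrib[where n=n]) (auto simp: line_proj_def)
  ultimately show ?thesis using v by (simp add: line_proj_def)
qed

definition has_projected_rows ::
  "nat \<Rightarrow> (complex \<Rightarrow> complex mat) \<Rightarrow> (complex \<Rightarrow> complex mat) \<Rightarrow> bool" where
  "has_projected_rows N g h \<longleftrightarrow>
     (AE z in circle_haar. Matrix.row (h z) 0 = Matrix.row (g z) 0 \<and>
        (\<forall>i\<in>{1..<N}. Matrix.row (h z) i = Matrix.row (g z) i - line_proj (Matrix.row (g z) 0) (Matrix.row (g z) i)))"

end

theory Submission
  imports Defs
begin

text \<open>The first column of the triangular factor is the only freedom in a factorization: for bounded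
  \<open>L\<^sub>1, \<dots>, L\<^bsub>N-1\<^esub>\<close> the other factor must be \<open>g\<close> with \<open>L\<^sub>i\<close> times the top row subtracted from
  row \<open>i\<close> (lemmas \<open>factorization_AE_eq\<close> and \<open>is_factorization_subtract_top_row\<close>). Hence the
  \<open>N - 1\<close> minimization problems do not interact.

  The isometries \<open>S\<^sub>j\<close> have orthogonal ranges that together span \<open>L\<^sup>2\<close>, so a function \<open>f\<^sub>i\<close> is determined
  by its components \<open>S\<^sub>j\<^sup>* f\<^sub>i\<close>, which may be prescribed freely, and \<open>\<parallel>f\<^sub>i\<parallel>\<^sup>2\<close> is the integral of the squared
  length of row \<open>i\<close> of the new factor (lemmas \<open>S_adj_synthesis\<close>, \<open>AE_eq_synthesis\<close>,
  \<open>L2_norm_synthesis\<close>). Each problem thus asks for the \<open>L\<^sub>i\<close> that minimizes the integral of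
  \<open>\<parallel>g\<^sub>i(z) - L\<^sub>i(z) g\<^sub>0(z)\<parallel>\<^sup>2\<close>. By Pythagoras the integrand exceeds its value at the projection
  coefficient \<open>c\<^sub>i(z)\<close> by exactly \<open>|L\<^sub>i(z) - c\<^sub>i(z)|\<^sup>2 \<parallel>g\<^sub>0(z)\<parallel>\<^sup>2\<close>. As \<open>g\<^sub>0(z) \<noteq> 0\<close> almost everywhere, the
  minimum is taken precisely for \<open>L\<^sub>i = c\<^sub>i\<close> (lemma \<open>is_minimizer_iff\<close>), and this is also precisely the
  condition that row \<open>i\<close> of the new factor be the projected one (lemma \<open>has_projected_rows_iff\<close>).

  It remains that \<open>c\<^sub>i\<close> is an allowed multiplier, that is, bounded. Its denominator is
  \<open>\<parallel>g\<^sub>0(z)\<parallel>\<^sup>2\<close>, and \<open>det g = 1\<close> with bounded entries keeps this away from 0 (lemma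
  \<open>SL_Linf_top_row_bounded_below\<close>).\<close>

section \<open>The power map and Haar measure\<close>

lemma emeasure_lborel_affine:
  fixes c t :: real
  assumes [measurable]: "B \<in> sets borel" and c: "c > 0"
  shows "emeasure lborel B = ennreal c * emeasure lborel {x. t + c * x \<in> B}"
proof -
  have [measurable]: "{x. t + c * x \<in> B} \<in> sets borel"
    by measurable
  have "(\<integral>\<^sup>+x. indicator B x \<partial>lborel) = \<bar>c\<bar> * (\<integral>\<^sup>+x. indicator B (t + c * x) \<partial>lborel)"
    by (rule nn_integral_real_affine) (use c in auto)
  also have "(\<lambda>x. indicator B (t + c * x) :: ennreal) = indicator {x. t + c * x \<in> B}"
    by (auto simp: indicator_def)
  finally show ?thesis using c by simp
qed

lemma power_circle_measurable [measurable]: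
  "(\<lambda>z. z ^ N) \<in> circle_haar \<rightarrow>\<^sub>M circle_haar"
  unfolding measurable_cong_sets[OF sets_circle_haar sets_circle_haar]
  by (intro measurable_restrict_space2 measurable_restrict_space1)
     (auto simp: space_restrict_space norm_power borel_measurable_continuous_onI continuous_intros)

lemma rotation_circle_measurable:
  assumes "norm c = 1"
  shows "(\<lambda>z. c * z) \<in> circle_haar \<rightarrow>\<^sub>M circle_haar"
  unfolding measurable_cong_sets[OF sets_circle_haar sets_circle_haar]
  by (intro measurable_restrict_space2 measurable_restrict_space1)
     (auto simp: space_restrict_space norm_mult assms borel_measurable_continuous_onI continuous_intros)

text \<open>In the angular variable the power map is \<open>t \<mapsto> N t\<close> modulo 1. Taking preimages under
  \<open>t \<mapsto> N t\<close> divides lengths by \<open>N\<close>, and this is compensated by the \<open>N\<close> copies of each subset of the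
  circle in \<open>[0, N)\<close>.\<close>

lemma power_preserves_circle_haar:
  assumes N: "N > 0"
  shows "distr circle_haar circle_haar (\<lambda>z. z ^ N) = circle_haar"
proof (rule measure_eqI)
  fix A assume "A \<in> sets (distr circle_haar circle_haar (\<lambda>z. z ^ N))"
  then have A: "A \<in> sets (restrict_space borel (sphere 0 1))" by simp
  then have Ab: "A \<in> sets borel" by (auto simp: sets_restrict_space)
  define E where "E = {t::real. cis (2 * pi * t) \<in> A}"
  have Eb [measurable]: "E \<in> sets borel"
  proof -
    have "(\<lambda>t. cis (2 * pi * t)) \<in> borel_measurable borel"
      by (simp add: cis_conv_exp borel_measurable_continuous_onI continuous_intros)
    from measurable_sets[OF this Ab] show ?thesis by (simp add: E_def vimage_def)
  qed
  have per: "cis (2 * pi * (real n + t)) = cis (2 * pi * t)" for t and n :: nat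
    using cis_multiple_2pi[of "real n"] by (simp add: distrib_left flip: cis_mult)
  have copies: "emeasure lborel (E \<inter> {0..<real n}) = of_nat n * emeasure lborel (E \<inter> {0..<1})" for n
  proof (induction n)
    case (Suc n)
    have "emeasure lborel (E \<inter> {real n..<real n + 1})
        = ennreal 1 * emeasure lborel {x. real n + 1 * x \<in> E \<inter> {real n..<real n + 1}}"
      by (rule emeasure_lborel_affine) auto
    also have "{x. real n + 1 * x \<in> E \<inter> {real n..<real n + 1}} = E \<inter> {0..<1}"
      by (auto simp: E_def per)
    finally have block: "emeasure lborel (E \<inter> {real n..<real n + 1}) = emeasure lborel (E \<inter> {0..<1})"
      by simp
    have "E \<inter> {0..<real (Suc n)} = (E \<inter> {0..<real n}) \<union> (E \<inter> {real n..<real n + 1})"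
      by auto
    also have "emeasure lborel \<dots>
        = emeasure lborel (E \<inter> {0..<real n}) + emeasure lborel (E \<inter> {real n..<real n + 1})"
      by (rule plus_emeasure[symmetric]) auto
    finally have "emeasure lborel (E \<inter> {0..<real (Suc n)})
        = of_nat n * emeasure lborel (E \<inter> {0..<1}) + emeasure lborel (E \<inter> {0..<1})"
      by (simp only: Suc block)
    then show ?case
      by (simp add: distrib_right add.commute)
  qed simp
  have "emeasure (distr circle_haar circle_haar (\<lambda>z. z ^ N)) A
      = emeasure circle_haar ((\<lambda>z. z ^ N) -` A \<inter> space circle_haar)"
    by (rule emeasure_distr) (use A in auto)
  also have "\<dots> = emeasure lborel {t. 0 \<le> t \<and> t < 1 \<and> cis (2 * pi * t) \<in> (\<lambda>z. z ^ N) -` A \<inter> space circle_haar}"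
    by (rule emeasure_circle_haar) (use measurable_sets[OF power_circle_measurable, of A N] A in simp)
  also have "{t. 0 \<le> t \<and> t < 1 \<and> cis (2 * pi * t) \<in> (\<lambda>z. z ^ N) -` A \<inter> space circle_haar}
      = {t. 0 + real N * t \<in> E \<inter> {0..<real N}}"
    using N by (auto simp: E_def Complex.DeMoivre mult_ac zero_le_mult_iff)
  finally have "ennreal (real N) * emeasure (distr circle_haar circle_haar (\<lambda>z. z ^ N)) A
      = ennreal (real N) * emeasure lborel {t. 0 + real N * t \<in> E \<inter> {0..<real N}}"
    by simp
  also have "\<dots> = emeasure lborel (E \<inter> {0..<real N})"
    by (rule emeasure_lborel_affine[symmetric]) (use N in auto)
  also have "\<dots> = ennreal (real N) * emeasure lborel (E \<inter> {0..<1})"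
    by (simp add: copies ennreal_of_nat_eq_real_of_nat)
  also have "E \<inter> {0..<1} = {t. 0 \<le> t \<and> t < 1 \<and> cis (2 * pi * t) \<in> A}"
    by (auto simp: E_def)
  also have "emeasure lborel \<dots> = emeasure circle_haar A"
    by (rule emeasure_circle_haar[OF A, symmetric])
  finally show "emeasure (distr circle_haar circle_haar (\<lambda>z. z ^ N)) A = emeasure circle_haar A"
    using N by (simp add: ennreal_mult_cancel_left)
qed simp

lemma AE_circle_power:
  assumes "N > 0" and "AE z in circle_haar. P z"
  shows "AE z in circle_haar. P (z ^ N)"
proof (rule AE_distrD[OF power_circle_measurable])
  show "AE z in distr circle_haar circle_haar (\<lambda>z. z ^ N). P z"
    unfolding power_preserves_circle_haar[OF assms(1)] by (rule assms(2))
qed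

lemma AE_on_circle: "AE z in circle_haar. norm z = 1"
  using AE_space[of circle_haar] by (auto simp: dist_norm)

interpretation circle_haar: finite_measure circle_haar
  by (rule finite_measureI) (use prob_circle_haar in simp)

lemma integral_circle_power:
  fixes G :: "complex \<Rightarrow> complex"
  assumes "N > 0" and "G \<in> borel_measurable circle_haar"
  shows "(\<integral>z. G (z ^ N) \<partial>circle_haar) = (\<integral>z. G z \<partial>circle_haar)"
  using integral_distr[OF power_circle_measurable[of N] assms(2)]
  unfolding power_preserves_circle_haar[OF assms(1)] by simp

text \<open>Rotation invariance gives \<open>\<integral> F = q \<integral> F\<close>.\<close>

lemma integral_rotation_character_eq_0:
  fixes F :: "complex \<Rightarrow> complex"
  assumes F: "F \<in> borel_measurable circle_haar" and c: "norm c = 1" and q: "q \<noteq> 1"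
    and eq: "\<And>z. norm z = 1 \<Longrightarrow> F (c * z) = q * F z"
  shows "(\<integral>z. F z \<partial>circle_haar) = 0"
proof -
  have "(\<integral>z. F z \<partial>circle_haar) = (\<integral>z. F (c * z) \<partial>circle_haar)"
    using integral_distr[OF rotation_circle_measurable[OF c] F]
    by (simp add: rotation_invariant_circle_haar[OF c])
  also have "\<dots> = (\<integral>z. q * F z \<partial>circle_haar)"
    by (rule Bochner_Integration.integral_cong) (auto simp: eq dist_norm)
  also have "\<dots> = q * (\<integral>z. F z \<partial>circle_haar)"
    by simp
  finally show ?thesis using q by simp
qed

section \<open>Bounded functions on the circle\<close>

lemma Linf_iff: "f \<in> Linf \<longleftrightarrow>
    f \<in> borel_measurable circle_haar \<and> (\<exists>C. AE z in circle_haar. norm (f z) \<le> C)"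
  by (simp add: Linf_def)

lemma Linf_measurable [measurable_dest]: "f \<in> Linf \<Longrightarrow> f \<in> borel_measurable circle_haar"
  by (simp add: Linf_def)

lemma Linf_boundedE:
  assumes "f \<in> Linf"
  obtains C where "C \<ge> 0" "AE z in circle_haar. norm (f z) \<le> C"
proof -
  obtain C where "AE z in circle_haar. norm (f z) \<le> C" using assms by (auto simp: Linf_iff)
  then have "AE z in circle_haar. norm (f z) \<le> max C 0" by eventually_elim simp
  then show ?thesis by (intro that[of "max C 0"]) auto
qed

lemma Linf_const: "(\<lambda>z. c) \<in> Linf"
  by (auto simp: Linf_iff)

lemma Linf_ident: "(\<lambda>z. z) \<in> Linf"
  unfolding Linf_iff
proof
  show "(\<lambda>z. z) \<in> borel_measurable circle_haar"
    unfolding measurable_cong_sets[OF sets_circle_haar refl]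
    by (intro measurable_restrict_space1) simp
  show "\<exists>C. AE z in circle_haar. norm z \<le> C"
    by (rule exI[of _ 1], rule eventually_mono[OF AE_on_circle]) simp
qed

lemma Linf_add:
  assumes [measurable]: "f \<in> Linf" "h \<in> Linf"
  shows "(\<lambda>z. f z + h z) \<in> Linf"
proof -
  obtain C where "C \<ge> 0" and C: "AE z in circle_haar. norm (f z) \<le> C"
    using Linf_boundedE[OF assms(1)] .
  obtain D where "D \<ge> 0" and D: "AE z in circle_haar. norm (h z) \<le> D"
    using Linf_boundedE[OF assms(2)] .
  have "AE z in circle_haar. norm (f z + h z) \<le> C + D"
    using C D by eventually_elim (intro norm_triangle_le add_mono)
  then show ?thesis by (auto simp: Linf_iff)
qed

lemma Linf_mult:
  assumes [measurable]: "f \<in> Linf" "h \<in> Linf"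
  shows "(\<lambda>z. f z * h z) \<in> Linf"
proof -
  obtain C where "C \<ge> 0" and C: "AE z in circle_haar. norm (f z) \<le> C"
    using Linf_boundedE[OF assms(1)] .
  obtain D where "D \<ge> 0" and D: "AE z in circle_haar. norm (h z) \<le> D"
    using Linf_boundedE[OF assms(2)] .
  have "AE z in circle_haar. norm (f z * h z) \<le> C * D"
    using C D by eventually_elim (auto simp: norm_mult intro!: mult_mono \<open>C \<ge> 0\<close>)
  then show ?thesis by (auto simp: Linf_iff)
qed

lemma Linf_cnj:
  assumes [measurable]: "f \<in> Linf"
  shows "(\<lambda>z. cnj (f z)) \<in> Linf"
proof -
  have "cnj \<in> borel_measurable borel"
    by (intro borel_measurable_continuous_onI continuous_intros)
  from measurable_compose[OF Linf_measurable[OF assms] this] assms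
  show ?thesis by (simp add: Linf_iff)
qed

lemma Linf_diff:
  assumes "f \<in> Linf" "h \<in> Linf"
  shows "(\<lambda>z. f z - h z) \<in> Linf"
  using Linf_add[OF assms(1) Linf_mult[OF Linf_const[of "-1"] assms(2)]] by simp

lemma Linf_sum:
  assumes "\<And>i. i \<in> I \<Longrightarrow> f i \<in> Linf"
  shows "(\<lambda>z. \<Sum>i\<in>I. f i z) \<in> Linf"
  using assms by (induction I rule: infinite_finite_induct) (auto intro: Linf_const Linf_add)

lemma Linf_power_ident: "(\<lambda>z. z ^ j) \<in> Linf"
  by (induction j) (auto intro: Linf_const Linf_mult Linf_ident)

lemma Linf_comp_power:
  assumes "N > 0" "f \<in> Linf"
  shows "(\<lambda>z. f (z ^ N)) \<in> Linf"
proof -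
  obtain C where "AE z in circle_haar. norm (f z) \<le> C" using assms(2) by (auto simp: Linf_iff)
  from AE_circle_power[OF assms(1) this] show ?thesis
    using measurable_compose[OF power_circle_measurable Linf_measurable[OF assms(2)]]
    by (auto simp: Linf_iff)
qed

lemma Linf_integrable: "f \<in> Linf \<Longrightarrow> integrable circle_haar f"
  by (auto simp: Linf_iff intro: circle_haar.integrable_const_bound)

lemma integrable_norm_square:
  assumes "f \<in> Linf"
  shows "integrable circle_haar (\<lambda>z. (norm (f z))\<^sup>2)"
proof -
  have "integrable circle_haar (\<lambda>z. norm (f z * f z))"
    by (intro integrable_norm Linf_integrable Linf_mult assms)
  then show ?thesis by (simp add: norm_mult power2_eq_square)
qed

lemma L2_norm_square: "(L2_norm f)\<^sup>2 = (\<integral>z. (norm (f z))\<^sup>2 \<partial>circle_haar)"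
  by (simp add: L2_norm_def)

lemma L2_norm_cong_AE:
  assumes "f \<in> Linf" "h \<in> Linf" "AE z in circle_haar. f z = h z"
  shows "L2_norm f = L2_norm h"
proof -
  have "(\<integral>z. (norm (f z))\<^sup>2 \<partial>circle_haar) = (\<integral>z. (norm (h z))\<^sup>2 \<partial>circle_haar)"
  proof (rule integral_cong_AE)
    show "AE z in circle_haar. (norm (f z))\<^sup>2 = (norm (h z))\<^sup>2"
      using assms(3) by eventually_elim simp
  qed (use assms integrable_norm_square in auto)
  then show ?thesis by (simp add: L2_norm_def)
qed

section \<open>Analysis and synthesis with the isometries\<close>

text \<open>The operator \<open>(a\<^sub>j) \<mapsto> \<Sum>\<^sub>j S\<^sub>j a\<^sub>j\<close>, which recovers a function from its components \<open>S\<^sub>j\<^sup>* f\<close>.\<close>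

definition synthesis :: "nat \<Rightarrow> (nat \<Rightarrow> complex \<Rightarrow> complex) \<Rightarrow> complex \<Rightarrow> complex" where
  "synthesis N a w = (\<Sum>j<N. w ^ j * a j (w ^ N))"

lemma cnj_mult_self_unit: "norm z = 1 \<Longrightarrow> cnj z * z = 1"
  by (metis complex_norm_square mult.commute of_real_1 one_power2)

lemma norm_root_unit:
  fixes w :: complex
  assumes "N > 0" "norm (w ^ N) = 1"
  shows "norm w = 1"
  using assms power_eq_1_iff[of "norm w" N] by (auto simp: norm_power)

lemma primitive_root_powers_distinct:
  assumes "j < N" "k < N" "j \<noteq> k"
  defines "\<omega> \<equiv> cis (2 * pi / real N)"
  shows "\<omega> ^ j * cnj \<omega> ^ k \<noteq> 1"
proof
  assume eq: "\<omega> ^ j * cnj \<omega> ^ k = 1"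
  have N: "N > 0" using assms by simp
  have "\<omega> ^ j = \<omega> ^ j * (cnj \<omega> * \<omega>) ^ k"
    by (subst cnj_mult_self_unit) (auto simp: \<omega>_def)
  also have "\<dots> = (\<omega> ^ j * cnj \<omega> ^ k) * \<omega> ^ k" by (simp add: power_mult_distrib mult_ac)
  finally have "\<omega> ^ j = \<omega> ^ k" by (simp add: eq)
  moreover have "\<omega> ^ i = cis (2 * pi * real i / real N)" for i
    unfolding \<omega>_def Complex.DeMoivre by (simp add: mult_ac)
  ultimately show False
    using bij_betw_imp_inj_on[OF Complex.bij_betw_roots_unity[OF N]] assms(1-3)
    by (auto dest: inj_onD)
qed

lemma primitive_root_power_N: "N > 0 \<Longrightarrow> cis (2 * pi / real N) ^ N = 1"
  unfolding Complex.DeMoivre by simp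

text \<open>Multiplication by a primitive root of unity permutes the \<open>N\<close>-th roots of \<open>z\<close>, so a sum over
  them of a nontrivial character vanishes.\<close>

lemma sum_nth_roots_orthogonal:
  assumes z: "norm z = 1" and j: "j < N" and k: "k < N"
  shows "(\<Sum>w | w ^ N = z. cnj w ^ j * w ^ k) = (if j = k then of_nat N else 0)"
proof (cases "j = k")
  case True
  have N: "N > 0" using j by simp
  have "(\<Sum>w | w ^ N = z. cnj w ^ j * w ^ k) = (\<Sum>w | w ^ N = z. 1)"
  proof (rule sum.cong)
    fix w assume "w \<in> {w. w ^ N = z}"
    then have "norm w = 1" using norm_root_unit N z by auto
    then show "cnj w ^ j * w ^ k = 1"
      by (simp add: True cnj_mult_self_unit flip: power_mult_distrib)
  qed simp
  also have "\<dots> = of_nat N" using card_nth_roots[of z N] z N by fastforce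
  finally show ?thesis using True by simp
next
  case False
  define \<omega> where "\<omega> = cis (2 * pi / real N)"
  have N: "N > 0" using j by simp
  have \<omega>0: "\<omega> \<noteq> 0" and \<omega>N: "\<omega> ^ N = 1"
    using primitive_root_power_N[OF N] by (auto simp: \<omega>_def)
  have "bij_betw (\<lambda>w. \<omega> * w) {w. w ^ N = z} {w. w ^ N = z}"
    by (rule bij_betwI[where g = "\<lambda>w. w / \<omega>"])
       (use \<omega>0 \<omega>N in \<open>auto simp: power_mult_distrib power_divide\<close>)
  then have "(\<Sum>w | w ^ N = z. cnj w ^ j * w ^ k) = (\<Sum>w | w ^ N = z. cnj (\<omega> * w) ^ j * (\<omega> * w) ^ k)"
    by (rule sum.reindex_bij_betw[symmetric])
  also have "\<dots> = (\<omega> ^ k * cnj \<omega> ^ j) * (\<Sum>w | w ^ N = z. cnj w ^ j * w ^ k)"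
    by (simp add: sum_distrib_left power_mult_distrib mult_ac)
  finally show ?thesis
    using primitive_root_powers_distinct[OF k j] False by (auto simp: \<omega>_def)
qed

lemma S_adj_synthesis:
  assumes z: "norm z = 1" and j: "j < N"
  shows "S_adj N j (synthesis N a) z = a j z"
proof -
  have "(\<Sum>w | w ^ N = z. cnj w ^ j * synthesis N a w)
      = (\<Sum>w | w ^ N = z. \<Sum>k<N. a k z * (cnj w ^ j * w ^ k))"
    by (rule sum.cong) (auto simp: synthesis_def sum_distrib_left mult_ac)
  also have "\<dots> = (\<Sum>k<N. a k z * (\<Sum>w | w ^ N = z. cnj w ^ j * w ^ k))"
    by (subst sum.swap) (simp add: sum_distrib_left)
  also have "\<dots> = (\<Sum>k<N. if j = k then a k z * of_nat N else 0)"
    using sum_nth_roots_orthogonal[OF z j] by (intro sum.cong) auto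
  also have "\<dots> = a j z * of_nat N" using j by simp
  finally show ?thesis using j by (simp add: S_adj_def)
qed

text \<open>The dual orthogonality relation: for \<open>v\<close> and \<open>w\<close> with the same \<open>N\<close>-th power, the geometric
  sum of the powers of the root of unity \<open>w / v\<close> vanishes unless \<open>v = w\<close>.\<close>

lemma synthesis_S_adj:
  assumes N: "N > 0" and w: "norm w = 1"
  shows "synthesis N (\<lambda>j. S_adj N j f) w = f w"
proof -
  have geo: "(\<Sum>j<N. (w * cnj v) ^ j) = (if v = w then of_nat N else 0)" if v: "v ^ N = w ^ N" for v
  proof (cases "v = w")
    case True
    then show ?thesis using w by (simp add: cnj_mult_self_unit mult.commute[of w])
  next
    case False
    have nv: "norm v = 1" using norm_root_unit[OF N, of v] v w by (simp add: norm_power)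
    have "w * cnj v \<noteq> 1"
    proof
      assume "w * cnj v = 1"
      then have "w * (cnj v * v) = v" by (metis mult.assoc mult_1)
      then show False using False cnj_mult_self_unit[OF nv] by simp
    qed
    moreover have "(w * cnj v) ^ N = 1"
    proof -
      have "(w * cnj v) ^ N = (cnj v * v) ^ N" by (simp add: power_mult_distrib v mult.commute)
      then show ?thesis by (simp add: cnj_mult_self_unit[OF nv])
    qed
    ultimately show ?thesis using False by (simp add: geometric_sum)
  qed
  have "synthesis N (\<lambda>j. S_adj N j f) w
      = (\<Sum>j<N. \<Sum>v | v ^ N = w ^ N. f v * (w * cnj v) ^ j) / of_nat N"
    by (simp add: synthesis_def S_adj_def sum_distrib_left sum_divide_distrib power_mult_distrib mult_ac)
  also have "(\<Sum>j<N. \<Sum>v | v ^ N = w ^ N. f v * (w * cnj v) ^ j)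
      = (\<Sum>v | v ^ N = w ^ N. f v * (\<Sum>j<N. (w * cnj v) ^ j))"
    by (subst sum.swap) (simp add: sum_distrib_left)
  also have "\<dots> = (\<Sum>v | v ^ N = w ^ N. if v = w then f v * of_nat N else 0)"
    by (intro sum.cong) (auto simp: geo)
  also have "\<dots> = f w * of_nat N"
    using finite_nth_roots[OF N] by simp
  finally show ?thesis using N by simp
qed

lemma Linf_synthesis:
  assumes "N > 0" "\<And>j. j < N \<Longrightarrow> a j \<in> Linf"
  shows "synthesis N a \<in> Linf"
  unfolding synthesis_def
  by (intro Linf_sum Linf_mult Linf_power_ident Linf_comp_power) (use assms in auto)

text \<open>The inversion formula holds at every point of the circle, and preimages of null sets under
  the power map are null sets.\<close>

lemma AE_eq_synthesis:
  assumes N: "N > 0" and eq: "\<And>j. j < N \<Longrightarrow> AE z in circle_haar. a j z = S_adj N j f z"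
  shows "AE w in circle_haar. f w = synthesis N a w"
proof -
  have "AE z in circle_haar. \<forall>j\<in>{..<N}. a j z = S_adj N j f z"
    using eq by (intro AE_finite_allI) auto
  from AE_circle_power[OF N this] AE_on_circle show ?thesis
  proof eventually_elim
    case (elim w)
    have "synthesis N a w = synthesis N (\<lambda>j. S_adj N j f) w"
      using elim(1) by (simp add: synthesis_def)
    then show ?case using synthesis_S_adj[OF N] elim(2) by simp
  qed
qed

text \<open>The ranges of the \<open>S\<^sub>j\<close> are mutually orthogonal because rotation by a primitive root of unity
  acts on them by different characters; each \<open>S\<^sub>j\<close> is isometric because the power map preserves the
  measure.\<close>

lemma L2_norm_synthesis:
  assumes N: "N > 0" and a: "\<And>j. j < N \<Longrightarrow> a j \<in> Linf"
  shows "(L2_norm (synthesis N a))\<^sup>2 = (\<integral>z. (\<Sum>j<N. (norm (a j z))\<^sup>2) \<partial>circle_haar)"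
proof -
  define F where "F j k w = (w ^ j * a j (w ^ N)) * cnj (w ^ k * a k (w ^ N))" for j k w
  define \<omega> where "\<omega> = cis (2 * pi / real N)"
  have F: "F j k \<in> Linf" if "j < N" "k < N" for j k
    unfolding F_def using that N a
    by (intro Linf_mult Linf_cnj Linf_power_ident Linf_comp_power) auto
  have off: "(\<integral>w. F j k w \<partial>circle_haar) = 0" if "j < N" "k < N" "j \<noteq> k" for j k
  proof (rule integral_rotation_character_eq_0)
    show "norm \<omega> = 1" by (simp add: \<omega>_def)
    show "\<omega> ^ j * cnj \<omega> ^ k \<noteq> 1"
      unfolding \<omega>_def by (rule primitive_root_powers_distinct[OF that])
    show "F j k \<in> borel_measurable circle_haar"
      using F[OF that(1,2)] by (rule Linf_measurable)
    have "\<omega> ^ N = 1" using primitive_root_power_N[OF N] by (simp add: \<omega>_def)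
    then show "F j k (\<omega> * z) = (\<omega> ^ j * cnj \<omega> ^ k) * F j k z" for z
      by (simp add: F_def power_mult_distrib mult_ac)
  qed
  have diag: "(\<integral>w. F j j w \<partial>circle_haar) = of_real (\<integral>z. (norm (a j z))\<^sup>2 \<partial>circle_haar)"
    if "j < N" for j
  proof -
    have "F j j w = of_real ((norm (a j (w ^ N)))\<^sup>2)" if "norm w = 1" for w
      using that by (simp only: F_def complex_norm_square[symmetric] norm_mult norm_power) simp
    then have "(\<integral>w. F j j w \<partial>circle_haar)
        = (\<integral>w. complex_of_real ((norm (a j (w ^ N)))\<^sup>2) \<partial>circle_haar)"
      by (intro Bochner_Integration.integral_cong) (auto simp: dist_norm)
    also have "\<dots> = (\<integral>w. complex_of_real ((norm (a j w))\<^sup>2) \<partial>circle_haar)"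
    proof (rule integral_circle_power[OF N])
      have [measurable]: "a j \<in> borel_measurable circle_haar"
        using a[OF that] by (rule Linf_measurable)
      show "(\<lambda>z. complex_of_real ((norm (a j z))\<^sup>2)) \<in> borel_measurable circle_haar"
        by measurable
    qed
    finally show ?thesis by (simp only: integral_complex_of_real)
  qed
  have "complex_of_real ((L2_norm (synthesis N a))\<^sup>2)
      = (\<integral>w. of_real ((norm (synthesis N a w))\<^sup>2) \<partial>circle_haar)"
    by (simp only: L2_norm_square integral_complex_of_real)
  also have "\<dots> = (\<integral>w. (\<Sum>j<N. \<Sum>k<N. F j k w) \<partial>circle_haar)"
    by (simp only: complex_norm_square synthesis_def F_def cnj_sum sum_product)
  also have "\<dots> = (\<Sum>j<N. \<Sum>k<N. \<integral>w. F j k w \<partial>circle_haar)"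
  proof -
    have "(\<integral>w. (\<Sum>j<N. \<Sum>k<N. F j k w) \<partial>circle_haar) = (\<Sum>j<N. \<integral>w. (\<Sum>k<N. F j k w) \<partial>circle_haar)"
      by (rule Bochner_Integration.integral_sum) (auto intro!: Linf_integrable Linf_sum F)
    also have "\<dots> = (\<Sum>j<N. \<Sum>k<N. \<integral>w. F j k w \<partial>circle_haar)"
      by (intro sum.cong refl Bochner_Integration.integral_sum) (auto intro!: Linf_integrable F)
    finally show ?thesis .
  qed
  also have "\<dots> = (\<Sum>j<N. \<Sum>k<N. if j = k then \<integral>w. F j j w \<partial>circle_haar else 0)"
    by (intro sum.cong) (auto simp: off)
  also have "\<dots> = of_real (\<Sum>j<N. \<integral>z. (norm (a j z))\<^sup>2 \<partial>circle_haar)"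
    by (simp add: diag)
  also have "(\<Sum>j<N. \<integral>z. (norm (a j z))\<^sup>2 \<partial>circle_haar) = (\<integral>z. (\<Sum>j<N. (norm (a j z))\<^sup>2) \<partial>circle_haar)"
    by (rule Bochner_Integration.integral_sum[symmetric]) (auto intro!: integrable_norm_square a)
  finally show ?thesis by (simp only: of_real_eq_iff)
qed

section \<open>Projection onto the top row\<close>

definition top_row_energy :: "complex mat \<Rightarrow> real" where
  "top_row_energy A = (\<Sum>j<dim_col A. (norm (A $$ (0, j)))\<^sup>2)"

text \<open>The scalar by which the top row is multiplied in \<open>line_proj\<close>.\<close>

definition proj_coeff :: "complex mat \<Rightarrow> nat \<Rightarrow> complex" where
  "proj_coeff A i =
     (Matrix.row A i \<bullet>c Matrix.row A 0) / (Matrix.row A 0 \<bullet>c Matrix.row A 0)"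

lemma line_proj_row:
  "line_proj (Matrix.row A 0) (Matrix.row A i) = proj_coeff A i \<cdot>\<^sub>v Matrix.row A 0"
  by (simp add: line_proj_def proj_coeff_def)

lemma row_cscalar_prod:
  assumes "A \<in> carrier_mat n N" "i < n" "k < n"
  shows "Matrix.row A i \<bullet>c Matrix.row A k = (\<Sum>j<N. A $$ (i, j) * cnj (A $$ (k, j)))"
  using assms by (auto simp: scalar_prod_def atLeast0LessThan intro!: sum.cong)

lemma proj_coeff_eq:
  assumes A: "A \<in> carrier_mat n N" and i: "i < n"
  shows "proj_coeff A i =
    (\<Sum>j<N. A $$ (i, j) * cnj (A $$ (0, j))) * inverse (of_real (top_row_energy A))"
proof -
  have "Matrix.row A 0 \<bullet>c Matrix.row A 0 = of_real (top_row_energy A)"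
    using A i by (subst row_cscalar_prod[OF A])
      (auto simp: top_row_energy_def complex_norm_square[symmetric])
  then show ?thesis
    unfolding proj_coeff_def using i by (subst row_cscalar_prod[OF A]) (auto simp: divide_inverse)
qed

text \<open>With \<open>c\<close> the projection coefficient, \<open>x - c v\<close> is orthogonal to \<open>v\<close>, and
  \<open>x - L v = (x - c v) - (L - c) v\<close>.\<close>

lemma pythagoras_line:
  fixes x v :: "nat \<Rightarrow> complex" and L c :: complex
  assumes V: "V = (\<Sum>j<N. (norm (v j))\<^sup>2)" "V \<noteq> 0"
    and c: "c = (\<Sum>j<N. x j * cnj (v j)) * inverse (of_real V)"
  shows "(\<Sum>j<N. (norm (x j - L * v j))\<^sup>2)
    = (\<Sum>j<N. (norm (x j - c * v j))\<^sup>2) + (norm (L - c))\<^sup>2 * V"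
proof -
  define y where "y j = x j - c * v j" for j
  have V': "of_real V = (\<Sum>j<N. v j * cnj (v j))"
    by (simp add: V complex_norm_square[symmetric])
  have orth: "(\<Sum>j<N. y j * cnj (v j)) = 0"
  proof -
    have "(\<Sum>j<N. y j * cnj (v j)) = (\<Sum>j<N. x j * cnj (v j)) - c * of_real V"
      unfolding V' sum_distrib_left sum_subtractf[symmetric] y_def
      by (intro sum.cong refl) (simp add: algebra_simps)
    also have "\<dots> = 0" using V(2) by (simp add: c)
    finally show ?thesis .
  qed
  have orth': "(\<Sum>j<N. v j * cnj (y j)) = 0"
    using arg_cong[OF orth, of cnj] by (simp add: mult_ac)
  have "complex_of_real (\<Sum>j<N. (norm (x j - L * v j))\<^sup>2)
      = (\<Sum>j<N. (y j - (L - c) * v j) * cnj (y j - (L - c) * v j))"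
    by (simp only: of_real_sum complex_norm_square y_def) (simp add: algebra_simps)
  also have "\<dots> = (\<Sum>j<N. y j * cnj (y j)) - (L - c) * (\<Sum>j<N. v j * cnj (y j))
      - cnj (L - c) * (\<Sum>j<N. y j * cnj (v j))
      + (L - c) * cnj (L - c) * (\<Sum>j<N. v j * cnj (v j))"
    unfolding sum_distrib_left sum_subtractf[symmetric] sum.distrib[symmetric]
    by (intro sum.cong refl) (simp add: algebra_simps)
  also have "\<dots> = complex_of_real ((\<Sum>j<N. (norm (y j))\<^sup>2) + (norm (L - c))\<^sup>2 * V)"
    by (simp only: orth orth' V'[symmetric] of_real_add of_real_mult of_real_sum
          complex_norm_square mult_zero_right diff_zero)
  finally show ?thesis by (simp only: of_real_eq_iff y_def)
qed

lemma SL_Linf_entry: "g \<in> SL_Linf N \<Longrightarrow> i < N \<Longrightarrow> j < N \<Longrightarrow> (\<lambda>z. g z $$ (i, j)) \<in> Linf"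
  by (simp add: SL_Linf_def)

lemma AE_SL_carrier:
  assumes "g \<in> SL_Linf N"
  shows "AE z in circle_haar. g z \<in> carrier_mat N N"
  using AE_on_circle by eventually_elim (use assms in \<open>auto simp: SL_Linf_def dist_norm\<close>)

text \<open>Every summand of the Leibniz expansion has exactly one factor from the top row.\<close>

lemma norm_det_le_top_row:
  fixes A :: "complex mat"
  assumes A: "A \<in> carrier_mat N N" and N: "N > 0"
    and C: "\<And>i j. i < N \<Longrightarrow> j < N \<Longrightarrow> norm (A $$ (i, j)) \<le> C"
  shows "norm (Determinant.det A) \<le> fact N * C ^ (N - 1) * sqrt (top_row_energy A)"
proof -
  have C0: "C \<ge> 0" using C[OF N N] norm_ge_zero order_trans by blast
  have top: "norm (A $$ (0, j)) \<le> sqrt (top_row_energy A)" if "j < N" for j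
  proof (rule real_le_rsqrt)
    show "(norm (A $$ (0, j)))\<^sup>2 \<le> top_row_energy A"
      unfolding top_row_energy_def using A that by (intro member_le_sum) auto
  qed
  have summand: "norm (signof p * (\<Prod>i=0..<N. A $$ (i, p i))) \<le> C ^ (N - 1) * sqrt (top_row_energy A)"
    if p: "p permutes {0..<N}" for p
  proof -
    have pN: "p i < N" if "i < N" for i using permutes_in_image[OF p, of i] that by simp
    have "norm (signof p * (\<Prod>i=0..<N. A $$ (i, p i))) = (\<Prod>i=0..<N. norm (A $$ (i, p i)))"
      by (simp add: norm_mult prod_norm sign_def)
    also have "\<dots> = norm (A $$ (0, p 0)) * (\<Prod>i\<in>{1..<N}. norm (A $$ (i, p i)))"
      using N by (simp add: prod.atLeast_Suc_lessThan)
    also have "\<dots> \<le> sqrt (top_row_energy A) * (\<Prod>i\<in>{1..<N}. C)"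
      using N pN C top by (intro mult_mono prod_mono prod_nonneg) (auto simp: top_row_energy_def sum_nonneg)
    finally show ?thesis by (simp add: mult.commute)
  qed
  have "norm (Determinant.det A)
      \<le> (\<Sum>p | p permutes {0..<N}. norm (signof p * (\<Prod>i=0..<N. A $$ (i, p i))))"
    unfolding det_def'[OF A] by (rule norm_sum)
  also have "\<dots> \<le> (\<Sum>p | p permutes {0..<N}. C ^ (N - 1) * sqrt (top_row_energy A))"
    by (rule sum_mono) (use summand in auto)
  also have "\<dots> = fact N * C ^ (N - 1) * sqrt (top_row_energy A)"
    using card_permutations[of "{0..<N}" N] by simp
  finally show ?thesis .
qed

text \<open>The determinant, which is 1, is a linear function of the top row with bounded coefficients, so
  the top row cannot be short.\<close>

lemma SL_Linf_top_row_bounded_below: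
  assumes g: "g \<in> SL_Linf N" and N: "N > 0"
  obtains \<delta> where "\<delta> > 0" "AE z in circle_haar. \<delta> \<le> top_row_energy (g z)"
proof -
  have "\<forall>i\<in>{..<N}. \<forall>j\<in>{..<N}. \<exists>C. C \<ge> 0 \<and> (AE z in circle_haar. norm (g z $$ (i, j)) \<le> C)"
    using SL_Linf_entry[OF g] Linf_boundedE by (metis lessThan_iff)
  then obtain B where B: "\<And>i j. i < N \<Longrightarrow> j < N \<Longrightarrow> B i j \<ge> 0"
      "\<And>i j. i < N \<Longrightarrow> j < N \<Longrightarrow> AE z in circle_haar. norm (g z $$ (i, j)) \<le> B i j"
    by (metis lessThan_iff)
  \<comment> \<open>The summand 1 makes \<open>C\<close> positive, so that \<open>K\<close> below can be divided by.\<close>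
  define C where "C = 1 + (\<Sum>i<N. \<Sum>j<N. B i j)"
  have BC: "B i j \<le> C" if "i < N" "j < N" for i j
  proof -
    have "B i j \<le> (\<Sum>j<N. B i j)" using that B by (intro member_le_sum) auto
    also have "\<dots> \<le> (\<Sum>i<N. \<Sum>j<N. B i j)"
      using that B by (intro member_le_sum[where f = "\<lambda>i. \<Sum>j<N. B i j"]) (auto intro: sum_nonneg)
    finally show ?thesis by (simp add: C_def)
  qed
  have C: "C \<ge> 1" using B by (auto simp: C_def intro!: sum_nonneg)
  define K where "K = fact N * C ^ (N - 1)"
  have K: "K > 0" using C by (simp add: K_def)
  have bound: "AE z in circle_haar. \<forall>i\<in>{..<N}. \<forall>j\<in>{..<N}. norm (g z $$ (i, j)) \<le> B i j"
    by (intro AE_finite_allI) (use B in auto)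
  have det1: "AE z in circle_haar. Determinant.det (g z) = 1" using g by (simp add: SL_Linf_def)
  have "AE z in circle_haar. (1 / K)\<^sup>2 \<le> top_row_energy (g z)"
    using bound AE_SL_carrier[OF g] det1
  proof eventually_elim
    case (elim z)
    have "norm (g z $$ (i, j)) \<le> C" if "i < N" "j < N" for i j
      using elim(1) BC[OF that] that by (meson lessThan_iff order_trans)
    from norm_det_le_top_row[OF elim(2) N this] have "1 \<le> K * sqrt (top_row_energy (g z))"
      by (simp add: elim(3) K_def)
    then have "1 / K \<le> sqrt (top_row_energy (g z))" using K by (simp add: field_simps)
    then have "(1 / K)\<^sup>2 \<le> (sqrt (top_row_energy (g z)))\<^sup>2" using K by (intro power_mono) auto
    then show ?case by (simp add: top_row_energy_def sum_nonneg)
  qed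
  with K show ?thesis by (intro that[of "(1 / K)\<^sup>2"]) auto
qed

lemma AE_top_row_energy_pos:
  assumes "g \<in> SL_Linf N" "N > 0"
  shows "AE z in circle_haar. top_row_energy (g z) > 0"
proof -
  obtain \<delta> where "\<delta> > 0" and *: "AE z in circle_haar. \<delta> \<le> top_row_energy (g z)"
    using SL_Linf_top_row_bounded_below[OF assms] .
  from * show ?thesis by eventually_elim (use \<open>\<delta> > 0\<close> in simp)
qed

lemma Linf_inverse_bounded_below:
  assumes f: "f \<in> Linf" and "\<delta> > 0" and below: "AE z in circle_haar. \<delta> \<le> norm (f z)"
  shows "(\<lambda>z. inverse (f z)) \<in> Linf"
  unfolding Linf_iff
proof
  have [measurable]: "f \<in> borel_measurable circle_haar" using f by (rule Linf_measurable)
  show "(\<lambda>z. inverse (f z)) \<in> borel_measurable circle_haar" by measurable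
  have "AE z in circle_haar. norm (inverse (f z)) \<le> inverse \<delta>"
    using below by eventually_elim (use \<open>\<delta> > 0\<close> in \<open>auto simp: norm_inverse intro: le_imp_inverse_le\<close>)
  then show "\<exists>C. AE z in circle_haar. norm (inverse (f z)) \<le> C" ..
qed

lemma Linf_cong_on_circle:
  assumes "f \<in> Linf" "\<And>z. norm z = 1 \<Longrightarrow> h z = f z"
  shows "h \<in> Linf"
proof -
  have "h \<in> borel_measurable circle_haar"
    using Linf_measurable[OF assms(1)] assms(2)
    by (subst measurable_cong[of _ _ f]) (auto simp: dist_norm)
  moreover obtain C where "AE z in circle_haar. norm (f z) \<le> C" using assms(1) by (auto simp: Linf_iff)
  then have "AE z in circle_haar. norm (h z) \<le> C"
    using AE_on_circle by eventually_elim (simp add: assms(2))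
  ultimately show ?thesis by (auto simp: Linf_iff)
qed

text \<open>Membership in \<open>SL_Linf\<close> fixes the matrix size on the circle only, so the explicit formula for
  the coefficient, which depends on the size, is available there alone.\<close>

lemma Linf_proj_coeff:
  assumes g: "g \<in> SL_Linf N" and i: "i < N"
  shows "(\<lambda>z. proj_coeff (g z) i) \<in> Linf"
proof -
  have N: "N > 0" using i by simp
  define E where "E z = (\<Sum>j<N. g z $$ (0, j) * cnj (g z $$ (0, j)))" for z
  have E: "E \<in> Linf"
    unfolding E_def by (intro Linf_sum Linf_mult Linf_cnj SL_Linf_entry[OF g]) (use N in auto)
  have car: "g z \<in> carrier_mat N N" if "norm z = 1" for z
    using g that by (auto simp: SL_Linf_def dist_norm)
  have E_eq: "E z = of_real (top_row_energy (g z))" if "norm z = 1" for z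
    using car[OF that] by (auto simp: E_def top_row_energy_def complex_norm_square[symmetric])
  obtain \<delta> where \<delta>: "\<delta> > 0" "AE z in circle_haar. \<delta> \<le> top_row_energy (g z)"
    using SL_Linf_top_row_bounded_below[OF g N] .
  have "AE z in circle_haar. \<delta> \<le> norm (E z)"
    using \<delta>(2) AE_on_circle by eventually_elim (simp add: E_eq)
  then have inv: "(\<lambda>z. inverse (E z)) \<in> Linf"
    by (rule Linf_inverse_bounded_below[OF E \<delta>(1)])
  have "(\<lambda>z. (\<Sum>j<N. g z $$ (i, j) * cnj (g z $$ (0, j))) * inverse (E z)) \<in> Linf"
    by (intro Linf_mult Linf_sum Linf_cnj SL_Linf_entry[OF g] inv) (use i N in auto)
  then show ?thesis
    by (rule Linf_cong_on_circle) (simp add: proj_coeff_eq[OF car i] E_eq)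
qed

section \<open>Factorizations and row operations\<close>

text \<open>This is \<open>\<Lambda>\<inverse> g\<close> for the triangular factor \<open>\<Lambda>\<close> with first column \<open>L\<close>.\<close>

definition subtract_top_row ::
  "nat \<Rightarrow> (complex \<Rightarrow> complex mat) \<Rightarrow> (nat \<Rightarrow> complex \<Rightarrow> complex) \<Rightarrow> complex \<Rightarrow> complex mat" where
  "subtract_top_row N g L z = mat N N (\<lambda>(i, j).
     if i = 0 then g z $$ (0, j) else g z $$ (i, j) - L i z * g z $$ (0, j))"

lemma lower_factor_carrier: "lower_factor N L z \<in> carrier_mat N N"
  by (simp add: lower_factor_def)

lemma subtract_top_row_carrier: "subtract_top_row N g L z \<in> carrier_mat N N"
  by (simp add: subtract_top_row_def)

lemma lower_factor_mult_entry:
  assumes A: "A \<in> carrier_mat N N" and i: "i < N" and j: "j < N"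
  shows "(lower_factor N L z * A) $$ (i, j)
    = (if i = 0 then A $$ (0, j) else L i z * A $$ (0, j) + A $$ (i, j))"
proof -
  have "(lower_factor N L z * A) $$ (i, j)
      = (\<Sum>k<N. (if i = k then 1 else if k = 0 then L i z else 0) * A $$ (k, j))"
    using assms by (auto simp: lower_factor_def scalar_prod_def atLeast0LessThan intro!: sum.cong)
  also have "\<dots> = (\<Sum>k<N. (if k = i then A $$ (i, j) else 0)
      + (if k = 0 then (if i = 0 then 0 else L i z * A $$ (0, j)) else 0))"
    by (intro sum.cong) auto
  also have "\<dots> = A $$ (i, j) + (if i = 0 then 0 else L i z * A $$ (0, j))"
    using i by (auto simp: sum.distrib)
  finally show ?thesis by auto
qed

lemma eq_lower_factor_mult_iff:
  assumes G: "g z \<in> carrier_mat N N" and A: "A \<in> carrier_mat N N" and N: "N > 0"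
  shows "g z = lower_factor N L z * A \<longleftrightarrow> A = subtract_top_row N g L z"
proof
  assume eq: "g z = lower_factor N L z * A"
  have e: "g z $$ (i, j) = (if i = 0 then A $$ (0, j) else L i z * A $$ (0, j) + A $$ (i, j))"
    if "i < N" "j < N" for i j
    unfolding eq by (rule lower_factor_mult_entry[OF A that])
  show "A = subtract_top_row N g L z"
    by (rule eq_matI) (use A N in \<open>auto simp: subtract_top_row_def e\<close>)
next
  assume eq: "A = subtract_top_row N g L z"
  show "g z = lower_factor N L z * A"
  proof (rule eq_matI)
    fix i j assume "i < dim_row (lower_factor N L z * A)" "j < dim_col (lower_factor N L z * A)"
    then have ij: "i < N" "j < N" using A by (auto simp: lower_factor_def)
    show "g z $$ (i, j) = (lower_factor N L z * A) $$ (i, j)"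
      unfolding lower_factor_mult_entry[OF A ij] by (use ij N in \<open>auto simp: eq subtract_top_row_def\<close>)
  qed (use G A in \<open>auto simp: lower_factor_def\<close>)
qed

lemma det_lower_factor: "Determinant.det (lower_factor N L z) = 1"
proof -
  have "Determinant.det (lower_factor N L z) = prod_list (diag_mat (lower_factor N L z))"
    by (rule det_lower_triangular[of N]) (auto simp: lower_factor_def)
  also have "\<dots> = 1"
    unfolding prod_list_diag_prod by (rule prod.neutral) (auto simp: lower_factor_def)
  finally show ?thesis .
qed

text \<open>The triangular factor has determinant 1, so dividing by it stays in \<open>SL\<^sub>N(L\<^sup>\<infinity>)\<close>. Every choice of
  bounded multipliers therefore occurs, and the \<open>L\<^sub>i\<close> can be optimized independently.\<close>

lemma is_factorization_subtract_top_row: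
  assumes g: "g \<in> SL_Linf N" and N: "N > 0" and L: "\<And>i. i \<in> {1..<N} \<Longrightarrow> L i \<in> Linf"
  shows "is_factorization N g L (subtract_top_row N g L)"
proof -
  have fac: "AE z in circle_haar. g z = lower_factor N L z * subtract_top_row N g L z"
    using AE_SL_carrier[OF g]
    by eventually_elim (simp add: eq_lower_factor_mult_iff subtract_top_row_carrier N)
  have "AE z in circle_haar. Determinant.det (g z) = 1" using g by (simp add: SL_Linf_def)
  with fac have det: "AE z in circle_haar. Determinant.det (subtract_top_row N g L z) = 1"
  proof eventually_elim
    case (elim z)
    then show ?case
      using det_mult[OF lower_factor_carrier subtract_top_row_carrier, of N L z g L z]
      by (simp add: det_lower_factor)
  qed
  have "(\<lambda>z. subtract_top_row N g L z $$ (i, j)) \<in> Linf" if "i < N" "j < N" for i j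
  proof (cases "i = 0")
    case True
    then show ?thesis using that SL_Linf_entry[OF g] by (simp add: subtract_top_row_def)
  next
    case False
    then have "(\<lambda>z. g z $$ (i, j) - L i z * g z $$ (0, j)) \<in> Linf"
      using that N by (intro Linf_diff Linf_mult SL_Linf_entry[OF g] L) auto
    then show ?thesis using that False by (simp add: subtract_top_row_def)
  qed
  with fac det L show ?thesis
    by (auto simp: is_factorization_def SL_Linf_def subtract_top_row_carrier)
qed

lemma factorization_AE_eq:
  assumes g: "g \<in> SL_Linf N" and N: "N > 0" and fac: "is_factorization N g L h"
  shows "AE z in circle_haar. h z = subtract_top_row N g L z"
proof -
  have h: "h \<in> SL_Linf N" and eq: "AE z in circle_haar. g z = lower_factor N L z * h z"
    using fac by (auto simp: is_factorization_def)
  from eq AE_SL_carrier[OF g] AE_SL_carrier[OF h] show ?thesis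
    by eventually_elim (metis eq_lower_factor_mult_iff[OF _ _ N])
qed

text \<open>Row \<open>i\<close> of the new factor and the projected row both arise from row \<open>i\<close> of \<open>g\<close> by subtracting a
  multiple of the top row. The multipliers can be compared because the top row is almost everywhere
  nonzero.\<close>

lemma has_projected_rows_iff:
  assumes g: "g \<in> SL_Linf N" and N: "N > 0" and fac: "is_factorization N g L h"
  shows "has_projected_rows N g h \<longleftrightarrow>
    (\<forall>i\<in>{1..<N}. AE z in circle_haar. L i z = proj_coeff (g z) i)"
proof -
  define Q where "Q z \<longleftrightarrow> Matrix.row (h z) 0 = Matrix.row (g z) 0 \<and>
      (\<forall>i\<in>{1..<N}. Matrix.row (h z) i =
         Matrix.row (g z) i - line_proj (Matrix.row (g z) 0) (Matrix.row (g z) i))" for z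
  have "AE z in circle_haar. Q z \<longleftrightarrow> (\<forall>i\<in>{1..<N}. L i z = proj_coeff (g z) i)"
    using factorization_AE_eq[OF g N fac] AE_SL_carrier[OF g] AE_top_row_energy_pos[OF g N]
  proof eventually_elim
    case (elim z)
    have "\<exists>j<N. g z $$ (0, j) \<noteq> 0"
    proof (rule ccontr)
      assume "\<not> ?thesis"
      then have "top_row_energy (g z) = 0" using elim(2) by (auto simp: top_row_energy_def)
      then show False using elim(3) by simp
    qed
    then obtain j0 where j0: "j0 < N" "g z $$ (0, j0) \<noteq> 0" by blast
    have row0: "Matrix.row (h z) 0 = Matrix.row (g z) 0"
      by (rule eq_vecI) (use elim(2) N in \<open>auto simp: elim(1) subtract_top_row_def\<close>)
    have entry: "Matrix.row (h z) i $ j = g z $$ (i, j) - L i z * g z $$ (0, j)"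
      if "i \<in> {1..<N}" "j < N" for i j
      using that by (auto simp: elim(1) subtract_top_row_def)
    have proj: "(Matrix.row (g z) i - line_proj (Matrix.row (g z) 0) (Matrix.row (g z) i)) $ j
        = g z $$ (i, j) - proj_coeff (g z) i * g z $$ (0, j)"
      if "i \<in> {1..<N}" "j < N" for i j
      using that elim(2) by (auto simp: line_proj_row)
    have "Matrix.row (h z) i = Matrix.row (g z) i - line_proj (Matrix.row (g z) 0) (Matrix.row (g z) i)
        \<longleftrightarrow> L i z = proj_coeff (g z) i" if i: "i \<in> {1..<N}" for i
    proof
      assume "Matrix.row (h z) i
        = Matrix.row (g z) i - line_proj (Matrix.row (g z) 0) (Matrix.row (g z) i)"
      with entry[OF i j0(1)] proj[OF i j0(1)]
      have "g z $$ (i, j0) - L i z * g z $$ (0, j0) = g z $$ (i, j0) - proj_coeff (g z) i * g z $$ (0, j0)"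
        by (metis (no_types))
      then have "L i z * g z $$ (0, j0) = proj_coeff (g z) i * g z $$ (0, j0)"
        by simp
      then show "L i z = proj_coeff (g z) i" using j0(2) by (metis mult_right_cancel)
    next
      assume eq: "L i z = proj_coeff (g z) i"
      show "Matrix.row (h z) i
        = Matrix.row (g z) i - line_proj (Matrix.row (g z) 0) (Matrix.row (g z) i)"
      proof (rule eq_vecI)
        fix j assume "j < dim_vec (Matrix.row (g z) i
          - line_proj (Matrix.row (g z) 0) (Matrix.row (g z) i))"
        then have "j < N" using elim(2) by (simp add: line_proj_row)
        then show "Matrix.row (h z) i $ j = (Matrix.row (g z) i
          - line_proj (Matrix.row (g z) 0) (Matrix.row (g z) i)) $ j"
          by (simp only: entry[OF i] proj[OF i] eq)
      qed (use elim(2) in \<open>simp add: line_proj_row elim(1) subtract_top_row_def\<close>)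
    qed
    then show ?case by (simp add: Q_def row0)
  qed
  then have "(AE z in circle_haar. Q z) \<longleftrightarrow>
      (AE z in circle_haar. \<forall>i\<in>{1..<N}. L i z = proj_coeff (g z) i)"
    by (rule eventually_subst)
  also have "\<dots> \<longleftrightarrow> (\<forall>i\<in>{1..<N}. AE z in circle_haar. L i z = proj_coeff (g z) i)"
    by (rule AE_finite_all) simp
  finally show ?thesis by (simp only: has_projected_rows_def Q_def)
qed

section \<open>The minimization problems\<close>

lemma represents_synthesis:
  assumes h: "h \<in> SL_Linf N"
  shows "represents N (\<lambda>i. synthesis N (\<lambda>j z. h z $$ (i, j))) h"
  unfolding represents_def
proof (intro ballI conjI allI impI)
  fix i assume i: "i \<in> {1..<N}"
  then show "synthesis N (\<lambda>j z. h z $$ (i, j)) \<in> Linf"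
    by (intro Linf_synthesis SL_Linf_entry[OF h]) auto
  fix j assume "j < N"
  then show "AE z in circle_haar. h z $$ (i, j) = S_adj N j (synthesis N (\<lambda>j z. h z $$ (i, j))) z"
    using AE_on_circle by (auto simp: S_adj_synthesis)
qed

lemma represents_AE_eq_synthesis:
  assumes "represents N f h" "i \<in> {1..<N}"
  shows "AE w in circle_haar. f i w = synthesis N (\<lambda>j z. h z $$ (i, j)) w"
  by (rule AE_eq_synthesis) (use assms in \<open>auto simp: represents_def\<close>)

text \<open>The squared norm of \<open>g\<^sub>i - P g\<^sub>i\<close>, which turns out to be the minimum.\<close>

definition residual_energy :: "nat \<Rightarrow> (complex \<Rightarrow> complex mat) \<Rightarrow> nat \<Rightarrow> real" where
  "residual_energy N g i = (\<integral>z. (\<Sum>j<N.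
     (norm (g z $$ (i, j) - proj_coeff (g z) i * g z $$ (0, j)))\<^sup>2) \<partial>circle_haar)"

text \<open>The excess over the least possible energy is the squared distance of \<open>L\<^sub>i\<close> from the
  projection coefficient, weighted by the squared length of the top row. As this weight is almost
  everywhere positive, the excess vanishes only if \<open>L\<^sub>i\<close> is the coefficient.\<close>

lemma L2_norm_represents:
  assumes g: "g \<in> SL_Linf N" and fac: "is_factorization N g L h"
    and rep: "represents N f h" and i: "i \<in> {1..<N}"
  defines "D \<equiv> \<lambda>z. \<Sum>j<N. (norm ((L i z - proj_coeff (g z) i) * g z $$ (0, j)))\<^sup>2"
  shows "(L2_norm (f i))\<^sup>2 = residual_energy N g i + (\<integral>z. D z \<partial>circle_haar)"
    and "(\<integral>z. D z \<partial>circle_haar) = 0 \<longleftrightarrow> (AE z in circle_haar. L i z = proj_coeff (g z) i)"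
proof -
  have N: "N > 0" and i': "i < N" "i \<noteq> 0" using i by auto
  have h: "h \<in> SL_Linf N" and L: "L i \<in> Linf" using fac i by (auto simp: is_factorization_def)
  have pc: "(\<lambda>z. proj_coeff (g z) i) \<in> Linf" by (rule Linf_proj_coeff[OF g i'(1)])
  have intD: "integrable circle_haar D"
    unfolding D_def using N
    by (intro Bochner_Integration.integrable_sum integrable_norm_square Linf_mult Linf_diff L pc
          SL_Linf_entry[OF g]) auto
  have intR: "integrable circle_haar (\<lambda>z. \<Sum>j<N.
      (norm (g z $$ (i, j) - proj_coeff (g z) i * g z $$ (0, j)))\<^sup>2)"
    using N i'
    by (intro Bochner_Integration.integrable_sum integrable_norm_square Linf_mult Linf_diff pc
          SL_Linf_entry[OF g]) auto
  have inth: "integrable circle_haar (\<lambda>z. \<Sum>j<N. (norm (h z $$ (i, j)))\<^sup>2)"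
    using i' by (intro Bochner_Integration.integrable_sum integrable_norm_square SL_Linf_entry[OF h]) auto
  have D_eq: "AE z in circle_haar. D z = (norm (L i z - proj_coeff (g z) i))\<^sup>2 * top_row_energy (g z)"
    using AE_SL_carrier[OF g]
    by eventually_elim (auto simp: D_def top_row_energy_def norm_mult power_mult_distrib sum_distrib_left)
  have "L2_norm (f i) = L2_norm (synthesis N (\<lambda>j z. h z $$ (i, j)))"
    using represents_AE_eq_synthesis[OF rep i] rep i N i'
    by (intro L2_norm_cong_AE Linf_synthesis SL_Linf_entry[OF h]) (auto simp: represents_def)
  then have "(L2_norm (f i))\<^sup>2 = (\<integral>z. (\<Sum>j<N. (norm (h z $$ (i, j)))\<^sup>2) \<partial>circle_haar)"
    using N i' by (simp add: L2_norm_synthesis SL_Linf_entry[OF h])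
  also have "\<dots> = (\<integral>z. (\<Sum>j<N.
      (norm (g z $$ (i, j) - proj_coeff (g z) i * g z $$ (0, j)))\<^sup>2) + D z \<partial>circle_haar)"
  proof (rule integral_cong_AE)
    show "AE z in circle_haar. (\<Sum>j<N. (norm (h z $$ (i, j)))\<^sup>2) =
        (\<Sum>j<N. (norm (g z $$ (i, j) - proj_coeff (g z) i * g z $$ (0, j)))\<^sup>2) + D z"
      using factorization_AE_eq[OF g N fac] AE_SL_carrier[OF g] AE_top_row_energy_pos[OF g N] D_eq
    proof eventually_elim
      case (elim z)
      have "(\<Sum>j<N. (norm (h z $$ (i, j)))\<^sup>2)
          = (\<Sum>j<N. (norm (g z $$ (i, j) - L i z * g z $$ (0, j)))\<^sup>2)"
        using i' by (intro sum.cong) (auto simp: elim(1) subtract_top_row_def)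
      also have "\<dots> = (\<Sum>j<N. (norm (g z $$ (i, j) - proj_coeff (g z) i * g z $$ (0, j)))\<^sup>2)
          + (norm (L i z - proj_coeff (g z) i))\<^sup>2 * top_row_energy (g z)"
      proof (rule pythagoras_line)
        show "top_row_energy (g z) = (\<Sum>j<N. (norm (g z $$ (0, j)))\<^sup>2)"
          using elim(2) by (simp add: top_row_energy_def)
      qed (use elim(3) proj_coeff_eq[OF elim(2) i'(1)] in auto)
      finally show ?case by (simp add: elim(4))
    qed
  qed (use intD intR inth in auto)
  also have "\<dots> = residual_energy N g i + (\<integral>z. D z \<partial>circle_haar)"
    unfolding residual_energy_def by (rule Bochner_Integration.integral_add[OF intR intD])
  finally show "(L2_norm (f i))\<^sup>2 = residual_energy N g i + (\<integral>z. D z \<partial>circle_haar)" .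
  have "(\<integral>z. D z \<partial>circle_haar) = 0 \<longleftrightarrow> (AE z in circle_haar. D z = 0)"
    by (rule integral_nonneg_eq_0_iff_AE[OF intD]) (simp add: D_def sum_nonneg)
  also have "\<dots> \<longleftrightarrow> (AE z in circle_haar. L i z = proj_coeff (g z) i)"
  proof (rule eventually_subst)
    show "AE z in circle_haar. D z = 0 \<longleftrightarrow> L i z = proj_coeff (g z) i"
      using D_eq AE_top_row_energy_pos[OF g N] by eventually_elim auto
  qed
  finally show "(\<integral>z. D z \<partial>circle_haar) = 0 \<longleftrightarrow> (AE z in circle_haar. L i z = proj_coeff (g z) i)" .
qed

lemma projection_factorization:
  assumes g: "g \<in> SL_Linf N" and N: "N > 0"
  shows "\<exists>L h. is_factorization N g L h \<and> (\<forall>i\<in>{1..<N}. AE z in circle_haar. L i z = proj_coeff (g z) i)"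
proof (intro exI conjI)
  show "is_factorization N g (\<lambda>i z. proj_coeff (g z) i) (subtract_top_row N g (\<lambda>i z. proj_coeff (g z) i))"
    by (rule is_factorization_subtract_top_row[OF g N]) (auto intro: Linf_proj_coeff[OF g])
qed simp

text \<open>All admissible values are at least the residual energy, and the projection factorization attains
  it; so the minimizers are the families without excess.\<close>

lemma is_minimizer_iff:
  assumes g: "g \<in> SL_Linf N" and fac: "is_factorization N g L h"
    and rep: "represents N f h" and i: "i \<in> {1..<N}"
  shows "is_minimizer N g i f \<longleftrightarrow> (AE z in circle_haar. L i z = proj_coeff (g z) i)"
proof -
  have N: "N > 0" using i by auto
  have ge: "residual_energy N g i \<le> (L2_norm (f' i))\<^sup>2" if f': "admissible N g f'" for f'
  proof -
    obtain L' h' where "is_factorization N g L' h'" "represents N f' h'"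
      using f' by (auto simp: admissible_def)
    from L2_norm_represents(1)[OF g this i] show ?thesis
      by (simp add: sum_nonneg)
  qed
  obtain L0 h0 where fac0: "is_factorization N g L0 h0"
    and L0: "AE z in circle_haar. L0 i z = proj_coeff (g z) i"
    using projection_factorization[OF g N] i by blast
  have "h0 \<in> SL_Linf N" using fac0 by (simp add: is_factorization_def)
  from represents_synthesis[OF this] obtain f0 where rep0: "represents N f0 h0" by blast
  have attained: "(L2_norm (f0 i))\<^sup>2 = residual_energy N g i"
    using L2_norm_represents[OF g fac0 rep0 i] L0 by simp
  have adm0: "admissible N g f0" and adm: "admissible N g f"
    using fac0 rep0 fac rep by (auto simp: admissible_def)
  have "is_minimizer N g i f \<longleftrightarrow> (L2_norm (f i))\<^sup>2 = residual_energy N g i"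
    unfolding is_minimizer_def is_arg_min_def
    using ge adm0 adm attained by (metis not_less order.order_iff_strict)
  then show ?thesis using L2_norm_represents[OF g fac rep i] by simp
qed

theorem corollary3p13:
  fixes N :: nat and g :: "complex \<Rightarrow> complex mat"
  assumes "N > 2" and "g \<in> SL_Linf N"
  shows
    "(\<forall>L h. is_factorization N g L h \<longrightarrow>
       (\<exists>f. represents N f h \<and>
          (\<forall>f'. represents N f' h \<longrightarrow>
             (\<forall>i\<in>{1..<N}. AE z in circle_haar. f' i z = f i z)))) \<and>
     (\<exists>L h. is_factorization N g L h \<and> has_projected_rows N g h) \<and>
     (\<forall>L h. is_factorization N g L h \<longrightarrow>
       (is_optimal N g L h \<longleftrightarrow> has_projected_rows N g h)) \<and>
     (\<forall>L h f. is_factorization N g L h \<and> has_projected_rows N g h \<and> represents N f h \<longrightarrow>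
       (\<forall>i\<in>{1..<N}. is_minimizer N g i f \<and>
          (\<forall>f'. is_minimizer N g i f' \<longrightarrow> (AE z in circle_haar. f' i z = f i z))))"
proof (intro conjI allI impI ballI)
  have N: "N > 0" using assms(1) by simp
  note g = assms(2)
  have rep_ex: "represents N (\<lambda>i. synthesis N (\<lambda>j z. h z $$ (i, j))) h"
    if "is_factorization N g L h" for L h
    using that by (intro represents_synthesis) (simp add: is_factorization_def)
  show "\<exists>f. represents N f h \<and> (\<forall>f'. represents N f' h \<longrightarrow>
      (\<forall>i\<in>{1..<N}. AE z in circle_haar. f' i z = f i z))"
    if "is_factorization N g L h" for L h
    using rep_ex[OF that] represents_AE_eq_synthesis by blast
  show "\<exists>L h. is_factorization N g L h \<and> has_projected_rows N g h"
    using projection_factorization[OF g N] has_projected_rows_iff[OF g N] by blast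
  show "is_optimal N g L h \<longleftrightarrow> has_projected_rows N g h" if fac: "is_factorization N g L h" for L h
    unfolding is_optimal_def has_projected_rows_iff[OF g N fac]
    using is_minimizer_iff[OF g fac] rep_ex[OF fac] fac by blast
  fix L h f i
  assume "is_factorization N g L h \<and> has_projected_rows N g h \<and> represents N f h"
    and i: "i \<in> {1..<N}"
  then have fac: "is_factorization N g L h" and pr: "has_projected_rows N g h"
    and rep: "represents N f h" by auto
  have L: "AE z in circle_haar. L i z = proj_coeff (g z) i"
    using pr i by (simp add: has_projected_rows_iff[OF g N fac])
  then show "is_minimizer N g i f" by (simp add: is_minimizer_iff[OF g fac rep i])
  fix f' assume min: "is_minimizer N g i f'"
  then obtain L' h' where fac': "is_factorization N g L' h'" and rep': "represents N f' h'"
    by (auto simp: is_minimizer_def is_arg_min_def admissible_def)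
  have L': "AE z in circle_haar. L' i z = proj_coeff (g z) i"
    using min by (simp add: is_minimizer_iff[OF g fac' rep' i])
  \<comment> \<open>Only row \<open>i\<close> can be compared: the other components of \<open>f'\<close> need not be optimal.\<close>
  have rows: "AE z in circle_haar. \<forall>j<N. h z $$ (i, j) = h' z $$ (i, j)"
    using factorization_AE_eq[OF g N fac] factorization_AE_eq[OF g N fac'] L L'
    by eventually_elim (use i in \<open>auto simp: subtract_top_row_def\<close>)
  have "AE w in circle_haar. f' i w = synthesis N (\<lambda>j z. h z $$ (i, j)) w"
  proof (rule AE_eq_synthesis[OF N])
    fix j assume "j < N"
    then have "AE z in circle_haar. h' z $$ (i, j) = S_adj N j (f' i) z"
      using rep' i by (simp add: represents_def)
    with rows show "AE z in circle_haar. h z $$ (i, j) = S_adj N j (f' i) z"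
      by eventually_elim (use \<open>j < N\<close> in auto)
  qed
  with represents_AE_eq_synthesis[OF rep i] show "AE z in circle_haar. f' i z = f i z"
    by eventually_elim simp
qed

end
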